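(* Let $m,n\geq 1$ be integers and let $R$ be a ring such that $\mathbb{Z}\smallsetminus\{0\}\subseteq U(R)$ (that is, for every nonzero integer $k$ the element $k\cdot 1_R$ is invertible in $R$) and $R$ satisfies the identity $$[[[\ldots[[x_{1},x_{2}],x_{3}],\ldots],x_{m}],x_{m+1}]=0.$$ If $S$ is a subring of the full matrix ring $M_{n}(R)$ such that $\{rI\mid r\in R\}\subseteq S$, then $S\cap U(M_{n}(R))=U(S)$.
   Context: All rings are associative with identity (not necessarily commutative), and every subring contains the identity of the larger ring. $U(\cdot)$ denotes the group of units of a ring, $M_n(R)$ the ring of $n\times n$ matrices over $R$, $I$ the $n\times n$ identity matrix, and $[x,y]=xy-yx$. *)

theory Defs
  imports "Jordan_Normal_Form.Matrix" "HOL-Algebra.Subrings"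
begin

definition commutator :: "'a :: ring \<Rightarrow> 'a \<Rightarrow> 'a" where
  "commutator x y = x * y - y * x"

text \<open>
  The left-normed commutator [[...[[x 1, x 2], x 3], ...], x k], for k \<ge> 1; it has weight k,
  so for k = 1 it is just x 1. The value x 0 is never used.
\<close>
definition left_normed_commutator :: "(nat \<Rightarrow> 'a :: ring) \<Rightarrow> nat \<Rightarrow> 'a" where
  "left_normed_commutator x k = foldl commutator (x 1) (map x [2..<Suc k])"

end

theory Submission
  imports Defs "Jordan_Normal_Form.Determinant"
begin

text \<open>
  Let \<open>A \<in> S\<close> be invertible over \<open>R\<close>, and let \<open>N\<close> be the ideal of \<open>R\<close> generated by all
  commutators. It suffices to find a left inverse of \<open>A\<close> in \<open>S\<close>, and since \<open>S\<close> contains the scalar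
  matrices, every combination \<open>\<Sum> c\<^sub>l A\<^sup>l\<close> with left coefficients \<open>c\<^sub>l \<in> R\<close> lies in \<open>S\<close>.

  Over the commutative ring \<open>R / N\<close> the inverse of a matrix is a polynomial in that matrix,
  by the argument for the Cayley-Hamilton theorem. Lifting the coefficients of this polynomial to
  \<open>R\<close> gives \<open>G \<in> S\<close> such that \<open>E = 1 - G A \<in> S\<close> has all its entries in \<open>N\<close>
  (\<open>one_is_polynomial_multiple_modulo_commutators\<close>). The main point is that such a matrix \<open>E\<close> is
  nilpotent (\<open>commutator_matrix_nilpotent\<close>). Then \<open>1 - E = G A\<close> is invertible by the geometric
  series, which stays inside \<open>S\<close>, and so \<open>A\<close> has a left inverse in \<open>S\<close>.

  For the nilpotency let \<open>T\<^sub>k\<close> be the ideal generated by the left-normed commutators of weight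
  \<open>k + 1\<close>, so that \<open>T\<^sub>1 = N\<close> and \<open>T\<^sub>m = 0\<close>. If all \<open>[u, z]\<close> with fixed \<open>u\<close> are central modulo an
  ideal, then expanding \<open>[[u, z w], v]\<close> gives \<open>[u, z] [w, v] = - [u, w] [z, v]\<close> modulo it
  (\<open>alternating_modulo_ideal\<close>). This has two consequences. With \<open>u = w = x\<close> and \<open>z = v = y\<close> one
  finds \<open>[x, y]\<^sup>2 \<in> T\<^sub>2\<close>, so modulo \<open>T\<^sub>2\<close> each commutator is central of square zero. With \<open>w\<close>
  itself a commutator one finds \<open>T\<^sub>k T\<^sub>2 \<subseteq> T\<^sub>k\<^sub>+\<^sub>1\<close> for \<open>k \<ge> 1\<close>, so \<open>T\<^sub>2\<close> is nilpotent. As the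
  entries of \<open>E\<close> involve only finitely many commutators, repeated squaring brings the entries
  of a power of \<open>E\<close> first into \<open>T\<^sub>2\<close> and then down the chain to \<open>T\<^sub>m = 0\<close>.
\<close>

section \<open>Two-sided ideals\<close>

inductive_set ideal_of :: "'a :: ring_1 set \<Rightarrow> 'a set" for X where
  zero: "0 \<in> ideal_of X"
| step: "x \<in> X \<Longrightarrow> s \<in> ideal_of X \<Longrightarrow> a * x * b + s \<in> ideal_of X"

lemma ideal_of_base: "x \<in> X \<Longrightarrow> x \<in> ideal_of X"
  using ideal_of.step[of x X 0 1 1] by (simp add: ideal_of.zero)

lemma ideal_of_add: "s \<in> ideal_of X \<Longrightarrow> t \<in> ideal_of X \<Longrightarrow> s + t \<in> ideal_of X"
  by (induction rule: ideal_of.induct) (auto simp: add.assoc intro: ideal_of.step)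

lemma ideal_of_mult_left: "s \<in> ideal_of X \<Longrightarrow> r * s \<in> ideal_of X"
proof (induction rule: ideal_of.induct)
  case (step x s a b)
  then show ?case
    using ideal_of.step[of x X "r * s" "r * a" b] by (simp add: distrib_left mult.assoc)
qed (simp add: ideal_of.zero)

lemma ideal_of_mult_right: "s \<in> ideal_of X \<Longrightarrow> s * r \<in> ideal_of X"
proof (induction rule: ideal_of.induct)
  case (step x s a b)
  then show ?case
    using ideal_of.step[of x X "s * r" a "b * r"] by (simp add: distrib_right mult.assoc)
qed (simp add: ideal_of.zero)

lemma ideal_of_uminus: "s \<in> ideal_of X \<Longrightarrow> - s \<in> ideal_of X"
  using ideal_of_mult_left[of s X "-1"] by simp

lemma ideal_of_diff: "s \<in> ideal_of X \<Longrightarrow> t \<in> ideal_of X \<Longrightarrow> s - t \<in> ideal_of X"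
  using ideal_of_add[of s X "- t"] ideal_of_uminus[of t X] by simp

lemmas ideal_of_closed =
  ideal_of.zero ideal_of_add ideal_of_mult_left ideal_of_mult_right ideal_of_uminus ideal_of_diff

lemma ideal_of_sum: "(\<And>i. i \<in> A \<Longrightarrow> f i \<in> ideal_of X) \<Longrightarrow> sum f A \<in> ideal_of X"
  by (induction A rule: infinite_finite_induct) (auto intro: ideal_of_closed)

lemma ideal_of_mono_ideal:
  assumes "X \<subseteq> ideal_of Y"
  shows "ideal_of X \<subseteq> ideal_of Y"
proof
  fix s assume "s \<in> ideal_of X"
  then show "s \<in> ideal_of Y"
    by induction (use assms in \<open>auto intro!: ideal_of.zero ideal_of_add ideal_of_mult_right[OF ideal_of_mult_left]\<close>)
qed

lemma ideal_of_mono: "X \<subseteq> Y \<Longrightarrow> ideal_of X \<subseteq> ideal_of Y"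
  by (rule ideal_of_mono_ideal) (auto intro: ideal_of_base)

lemma ideal_of_trivial: "X \<subseteq> {0} \<Longrightarrow> ideal_of X \<subseteq> {0}"
proof
  fix s assume "X \<subseteq> {0}" "s \<in> ideal_of X"
  from this(2,1) show "s \<in> {0}" by induction auto
qed

text \<open>
  In a Lie nilpotent ring the ideal of all commutators need not be nilpotent, but finitely many
  commutators generate a nilpotent one. A single matrix involves only finitely many.
\<close>
lemma ideal_of_finitary:
  assumes "s \<in> ideal_of X"
  obtains F where "finite F" "F \<subseteq> X" "s \<in> ideal_of F"
proof -
  from assms have "\<exists>F. finite F \<and> F \<subseteq> X \<and> s \<in> ideal_of F"
  proof induction
    case zero
    show ?case by (rule exI[of _ "{}"]) (auto intro: ideal_of.zero)
  next
    case (step x s a b)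
    then obtain F where F: "finite F" "F \<subseteq> X" "s \<in> ideal_of F" by auto
    then have "s \<in> ideal_of (insert x F)"
      using ideal_of_mono[of F "insert x F"] by auto
    then show ?case using F step.hyps
      by (intro exI[of _ "insert x F"]) (auto intro: ideal_of.step)
  qed
  then show ?thesis using that by blast
qed

lemma ideal_of_times:
  assumes sandwich: "\<And>x r y. x \<in> X \<Longrightarrow> y \<in> Y \<Longrightarrow> x * r * y \<in> ideal_of Z"
    and u: "u \<in> ideal_of X" and v: "v \<in> ideal_of Y"
  shows "u * v \<in> ideal_of Z"
  using u
proof induction
  case zero
  show ?case by (simp add: ideal_of.zero)
next
  case (step x s a b)
  from v have "a * x * b * v \<in> ideal_of Z"
  proof induction
    case zero
    show ?case by (simp add: ideal_of.zero)
  next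
    case (step y t c d)
    have "a * (x * (b * c) * y) * d \<in> ideal_of Z"
      using \<open>x \<in> X\<close> \<open>y \<in> Y\<close> by (intro ideal_of_mult_left ideal_of_mult_right sandwich)
    with step.IH show ?case
      using ideal_of_add by (fastforce simp: distrib_left mult.assoc)
  qed
  with step.IH show ?case
    using ideal_of_add by (fastforce simp: distrib_right)
qed

section \<open>Products of higher commutators\<close>

text \<open>
  The left-normed commutators of weight \<open>k + 1\<close>. The index counts the brackets, so that the
  hypothesis on weight \<open>m + 1\<close> says that level \<open>m\<close> vanishes.
\<close>
primrec lower_commutators :: "nat \<Rightarrow> 'a :: ring_1 set" where
  "lower_commutators 0 = UNIV"
| "lower_commutators (Suc k) = {commutator u z | u z. u \<in> lower_commutators k}"

lemma lower_commutatorsI: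
  "u \<in> lower_commutators k \<Longrightarrow> commutator u z \<in> lower_commutators (Suc k)"
  by auto

lemma lower_commutators_left_normed:
  fixes w :: "'a :: ring_1"
  assumes "w \<in> lower_commutators k"
  shows "\<exists>x :: nat \<Rightarrow> 'a. w = left_normed_commutator x (Suc k)"
  using assms
proof (induction k arbitrary: w)
  case 0
  show ?case by (rule exI[of _ "\<lambda>_. w"]) (simp add: left_normed_commutator_def)
next
  case (Suc k)
  then obtain u z where w: "w = commutator u z" and "u \<in> lower_commutators k" by auto
  then obtain x where u: "u = left_normed_commutator x (Suc k)" using Suc.IH by blast
  let ?y = "x(Suc (Suc k) := z)"
  have "map ?y [2..<Suc (Suc k)] = map x [2..<Suc (Suc k)]" by auto
  then have "left_normed_commutator ?y (Suc (Suc k)) = commutator u z"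
    unfolding u left_normed_commutator_def by simp
  then show ?case unfolding w by metis
qed

lemma lower_commutators_antimono: "lower_commutators (Suc k) \<subseteq> lower_commutators k"
  by (induction k) auto

lemma lower_commutators_antimono_le: "j \<le> k \<Longrightarrow> lower_commutators k \<subseteq> lower_commutators j"
  by (rule lift_Suc_antimono_le[of lower_commutators]) (rule lower_commutators_antimono)

text \<open>
  Expand \<open>[[u, z w], v]\<close>, where \<open>[u, z w] = [u, z] w + z [u, w]\<close>, by the product rule. The terms
  with a double bracket of \<open>u\<close> vanish modulo the ideal and leave
  \<open>[u, z] [w, v] + [z, v] [u, w]\<close>, whose second product may be commuted.
\<close>
lemma alternating_modulo_ideal:
  assumes central: "\<And>z v. commutator (commutator u z) v \<in> ideal_of X"
  shows "commutator u z * commutator w v + commutator u w * commutator z v \<in> ideal_of X"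
proof -
  have "commutator u z * commutator w v + commutator u w * commutator z v =
      commutator (commutator u (z * w)) v - commutator (commutator u z) v * w
      - z * commutator (commutator u w) v + commutator (commutator u w) (commutator z v)"
    by (simp add: commutator_def algebra_simps)
  also have "\<dots> \<in> ideal_of X"
    by (intro ideal_of_closed central)
  finally show ?thesis .
qed

text \<open>
  Swap \<open>z\<close> and \<open>w = [p, q]\<close> with the alternating law: the factor \<open>[u, [p, q]]\<close> that appears
  is a difference of double brackets of \<open>u\<close> by the Jacobi identity.
\<close>
lemma commutator_times_triple:
  assumes central: "\<And>z v. commutator (commutator u z) v \<in> ideal_of X"
  shows "commutator u z * commutator (commutator p q) v \<in> ideal_of X"
proof -
  have "commutator u (commutator p q) = 
      commutator (commutator u p) q - commutator (commutator u q) p"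
    by (simp add: commutator_def algebra_simps)
  then have "commutator u (commutator p q) \<in> ideal_of X"
    by (simp add: ideal_of_diff central)
  then have "(commutator u z * commutator (commutator p q) v
      + commutator u (commutator p q) * commutator z v)
      - commutator u (commutator p q) * commutator z v \<in> ideal_of X"
    by (intro ideal_of_diff alternating_modulo_ideal central ideal_of_mult_right)
  then show ?thesis by simp
qed

lemma sandwich_modulo_ideal:
  assumes "x * y \<in> ideal_of X" and "commutator x r \<in> ideal_of X"
  shows "x * r * y \<in> ideal_of X"
proof -
  have "x * r * y = r * (x * y) + commutator x r * y"
    by (simp add: commutator_def algebra_simps)
  also have "\<dots> \<in> ideal_of X" by (intro ideal_of_closed assms)
  finally show ?thesis .
qed

lemma commutator_in_ideal:
  "u \<in> lower_commutators k \<Longrightarrow> commutator u z \<in> ideal_of (lower_commutators (Suc k))"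
  by (intro ideal_of_base lower_commutatorsI)

text \<open>
  The alternating law for \<open>c = [x, y]\<close> exchanges the middle entries of \<open>[x, y] [x, y]\<close> and
  produces \<open>[x, x] [y, y] = 0\<close>.
\<close>
lemma square_single_commutator:
  assumes "c \<in> lower_commutators 1"
  shows "c * r * c \<in> ideal_of (lower_commutators 2)"
proof (rule sandwich_modulo_ideal)
  from assms obtain x y where c: "c = commutator x y" by auto
  have "commutator x y * commutator x y + commutator x x * commutator y y
      \<in> ideal_of (lower_commutators 2)"
    unfolding numeral_2_eq_2
    by (intro alternating_modulo_ideal commutator_in_ideal lower_commutatorsI) simp
  then show "c * c \<in> ideal_of (lower_commutators 2)"
    unfolding c by (simp add: commutator_def)
  show "commutator c r \<in> ideal_of (lower_commutators 2)"
    using commutator_in_ideal[OF assms] by (simp add: numeral_2_eq_2)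
qed

text \<open>
  This is \<open>T\<^sub>k\<^sub>+\<^sub>1 T\<^sub>2 \<subseteq> T\<^sub>k\<^sub>+\<^sub>2\<close> on generators, the step by which powers of \<open>T\<^sub>2\<close> descend
  through the series.
\<close>
lemma lower_times_triple:
  assumes "x \<in> lower_commutators (Suc k)" and "y \<in> lower_commutators 2"
  shows "x * r * y \<in> ideal_of (lower_commutators (Suc (Suc k)))"
proof (rule sandwich_modulo_ideal)
  from assms(1) obtain u z where x: "x = commutator u z" and u: "u \<in> lower_commutators k" by auto
  from assms(2) obtain p q v where y: "y = commutator (commutator p q) v"
    by (auto simp: numeral_2_eq_2)
  show "x * y \<in> ideal_of (lower_commutators (Suc (Suc k)))"
    unfolding x y
    by (rule commutator_times_triple) (intro commutator_in_ideal lower_commutatorsI u)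
  show "commutator x r \<in> ideal_of (lower_commutators (Suc (Suc k)))"
    using assms(1) by (rule commutator_in_ideal)
qed

section \<open>Matrices over the commutator ideal are nilpotent\<close>

definition mats_over :: "nat \<Rightarrow> 'a set \<Rightarrow> 'a mat set" where
  "mats_over n I = {A \<in> carrier_mat n n. \<forall>i<n. \<forall>j<n. A $$ (i, j) \<in> I}"

lemma mats_over_mono: "I \<subseteq> J \<Longrightarrow> mats_over n I \<subseteq> mats_over n J"
  by (auto simp: mats_over_def)

lemma pow_mat_add:
  assumes "A \<in> carrier_mat n n"
  shows "A ^\<^sub>m (k + l) = A ^\<^sub>m k * A ^\<^sub>m l"
proof (induction l)
  case 0
  have "A ^\<^sub>m k \<in> carrier_mat n n" using assms by simp
  then show ?case using assms by simp
next
  case (Suc l)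
  then show ?case
    using assms by (simp add: assoc_mult_mat[of _ n n _ n _ n])
qed

lemma square_mats_over:
  assumes A: "A \<in> mats_over n (ideal_of X)"
    and sandwich: "\<And>x r y. x \<in> X \<Longrightarrow> y \<in> X \<Longrightarrow> x * r * y \<in> ideal_of Z"
  shows "A * A \<in> mats_over n (ideal_of Z)"
proof -
  from A have dim: "A \<in> carrier_mat n n" and entry: "\<And>i j. i < n \<Longrightarrow> j < n \<Longrightarrow> A $$ (i, j) \<in> ideal_of X"
    by (auto simp: mats_over_def)
  have "(A * A) $$ (i, j) \<in> ideal_of Z" if "i < n" "j < n" for i j
  proof -
    have "(A * A) $$ (i, j) = (\<Sum>k = 0..<n. A $$ (i, k) * A $$ (k, j))"
      using dim that by (auto simp: scalar_prod_def)
    also have "\<dots> \<in> ideal_of Z"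
    proof (rule ideal_of_sum)
      fix k assume "k \<in> {0..<n}"
      then show "A $$ (i, k) * A $$ (k, j) \<in> ideal_of Z"
        using that by (intro ideal_of_times[OF sandwich, of X X] entry) auto
    qed
    finally show ?thesis .
  qed
  then show ?thesis using dim by (auto simp: mats_over_def)
qed

text \<open>
  The generators in \<open>F\<close> are removed one at a time. For \<open>c \<in> F\<close> the induction hypothesis, with
  \<open>c\<close> moved into \<open>G\<close>, gives a power with entries in the ideal of \<open>G\<close> and \<open>c\<close>; its square has
  entries in the ideal of \<open>G\<close> alone, because \<open>c r c\<close> lies there.
\<close>
lemma power_kills_commutators:
  assumes "finite F" and "F \<subseteq> lower_commutators 1"
    and "lower_commutators 2 \<subseteq> ideal_of G"
    and "A \<in> mats_over n (ideal_of (G \<union> F))"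
  shows "\<exists>t. A ^\<^sub>m t \<in> mats_over n (ideal_of G)"
  using assms
proof (induction F arbitrary: G rule: finite_induct)
  case empty
  then have "A ^\<^sub>m 1 = A" by (simp add: mats_over_def)
  with empty show ?case by (intro exI[of _ 1]) simp
next
  case (insert c F)
  have "ideal_of G \<subseteq> ideal_of (insert c G)" by (rule ideal_of_mono) auto
  with insert obtain t where t: "A ^\<^sub>m t \<in> mats_over n (ideal_of (insert c G))"
    by (metis Un_insert_left Un_insert_right insert_subset subset_trans)
  have "A ^\<^sub>m t * A ^\<^sub>m t \<in> mats_over n (ideal_of G)"
  proof (rule square_mats_over[OF t])
    fix x r y assume xy: "x \<in> insert c G" "y \<in> insert c G"
    have "c * r * c \<in> ideal_of G"
      using square_single_commutator[of c r] ideal_of_mono_ideal[OF insert.prems(2)] insert.prems(1)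
      by auto
    with xy show "x * r * y \<in> ideal_of G"
      by (auto intro: ideal_of_mult_left ideal_of_mult_right ideal_of_base)
  qed
  then have "A ^\<^sub>m (t + t) \<in> mats_over n (ideal_of G)"
    using insert.prems(3) by (subst pow_mat_add[of _ n]) (auto simp: mats_over_def)
  then show ?case by blast
qed

lemma power_descends:
  assumes "A \<in> mats_over n (ideal_of (lower_commutators 2))"
  shows "\<exists>t. A ^\<^sub>m t \<in> mats_over n (ideal_of (lower_commutators (2 + k)))"
proof (induction k)
  case 0
  have "A ^\<^sub>m 1 = A" using assms by (simp add: mats_over_def)
  with assms show ?case by (intro exI[of _ 1]) simp
next
  case (Suc k)
  then obtain t where t: "A ^\<^sub>m t \<in> mats_over n (ideal_of (lower_commutators (2 + k)))" by blast
  have "A ^\<^sub>m t * A ^\<^sub>m t \<in> mats_over n (ideal_of (lower_commutators (2 + Suc k)))"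
  proof (rule square_mats_over[OF t])
    fix x r y :: 'a
    assume "x \<in> lower_commutators (2 + k)" "y \<in> lower_commutators (2 + k)"
    then show "x * r * y \<in> ideal_of (lower_commutators (2 + Suc k))"
      using lower_times_triple[of x "Suc k" y r] lower_commutators_antimono_le[of 2 "2 + k"] by auto
  qed
  then have "A ^\<^sub>m (t + t) \<in> mats_over n (ideal_of (lower_commutators (2 + Suc k)))"
    using assms by (subst pow_mat_add[of _ n]) (auto simp: mats_over_def)
  then show ?case by blast
qed

lemma finite_commutators_for_matrix:
  assumes A: "A \<in> mats_over n (ideal_of X)"
  obtains F where "finite F" "F \<subseteq> X" "A \<in> mats_over n (ideal_of F)"
proof -
  have "\<exists>F. i < n \<longrightarrow> j < n \<longrightarrow> finite F \<and> F \<subseteq> X \<and> A $$ (i, j) \<in> ideal_of F" for i j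
  proof (cases "i < n \<and> j < n")
    case True
    then have "A $$ (i, j) \<in> ideal_of X" using A by (simp add: mats_over_def)
    then show ?thesis by (rule ideal_of_finitary) blast
  qed auto
  then obtain F where F: "\<And>i j. i < n \<Longrightarrow> j < n \<Longrightarrow>
      finite (F i j) \<and> F i j \<subseteq> X \<and> A $$ (i, j) \<in> ideal_of (F i j)"
    by metis
  let ?F = "\<Union>i<n. \<Union>j<n. F i j"
  have "ideal_of (F i j) \<subseteq> ideal_of ?F" if "i < n" "j < n" for i j
    using that by (intro ideal_of_mono) auto
  then have "A \<in> mats_over n (ideal_of ?F)"
    using A F by (auto simp: mats_over_def) blast
  moreover have "finite ?F" "?F \<subseteq> X" using F by auto
  ultimately show ?thesis using that by blast
qed

lemma commutator_matrix_nilpotent: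
  fixes A :: "'a :: ring_1 mat"
  assumes A: "A \<in> mats_over n (ideal_of (lower_commutators 1))"
    and nil: "lower_commutators m \<subseteq> {0 :: 'a}"
  shows "\<exists>t. A ^\<^sub>m t = 0\<^sub>m n n"
proof -
  obtain F where F: "finite F" "F \<subseteq> lower_commutators 1" "A \<in> mats_over n (ideal_of F)"
    using finite_commutators_for_matrix[OF A] by blast
  have "A \<in> mats_over n (ideal_of (lower_commutators 2 \<union> F))"
    using F(3) mats_over_mono[OF ideal_of_mono, of F "lower_commutators 2 \<union> F" n] by auto
  then obtain s where s: "A ^\<^sub>m s \<in> mats_over n (ideal_of (lower_commutators 2))"
    using power_kills_commutators[OF F(1,2)] by (meson ideal_of_base subsetI)
  obtain t where t: "(A ^\<^sub>m s) ^\<^sub>m t \<in> mats_over n (ideal_of (lower_commutators (2 + m)))"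
    using power_descends[OF s] by blast
  have "lower_commutators (2 + m) \<subseteq> {0 :: 'a}"
    using lower_commutators_antimono_le[of m "2 + m"] nil by (metis le_add2 subset_trans)
  then have "ideal_of (lower_commutators (2 + m)) \<subseteq> {0 :: 'a}" by (rule ideal_of_trivial)
  with t have "(A ^\<^sub>m s) ^\<^sub>m t = 0\<^sub>m n n"
    by (intro eq_matI) (auto simp: mats_over_def)
  moreover have "(A ^\<^sub>m s) ^\<^sub>m t = A ^\<^sub>m (s * t)"
  proof (induction t)
    case (Suc t)
    have "A \<in> carrier_mat n n" using A by (simp add: mats_over_def)
    then have "A ^\<^sub>m (s * t + s) = A ^\<^sub>m (s * t) * A ^\<^sub>m s" by (rule pow_mat_add)
    with Suc show ?case by (simp add: add.commute)
  qed simp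
  ultimately show ?thesis by metis
qed

section \<open>The commutative quotient\<close>

abbreviation commutator_ideal :: "'a :: ring_1 set" where
  "commutator_ideal \<equiv> ideal_of (lower_commutators 1)"

text \<open>
  The determinant needs a type of commutative rings with \<open>0 \<noteq> 1\<close>, but the quotient by the
  commutator ideal is the zero ring for some rings, for example the \<open>2 \<times> 2\<close> matrices over a field. The
  direct product with the integers is always nontrivial.
\<close>
definition congruent_modulo_commutators :: "'a :: ring_1 \<times> int \<Rightarrow> 'a \<times> int \<Rightarrow> bool" where
  "congruent_modulo_commutators p q \<longleftrightarrow> fst p - fst q \<in> commutator_ideal \<and> snd p = snd q"

lemma equivp_congruent_modulo_commutators: "equivp congruent_modulo_commutators"
proof (rule equivpI)
  show "reflp congruent_modulo_commutators"
    by (rule reflpI) (simp add: congruent_modulo_commutators_def ideal_of.zero)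
  show "symp congruent_modulo_commutators"
    by (rule sympI) (auto simp: congruent_modulo_commutators_def dest: ideal_of_uminus)
  show "transp congruent_modulo_commutators"
    by (rule transpI) (auto simp: congruent_modulo_commutators_def dest: ideal_of_add)
qed

quotient_type (overloaded) 'a abelianization = "'a :: ring_1 \<times> int" / congruent_modulo_commutators
  by (rule equivp_congruent_modulo_commutators)

instantiation abelianization :: (ring_1) comm_ring_1
begin

lift_definition zero_abelianization :: "'a abelianization" is "(0, 0)" .

lift_definition one_abelianization :: "'a abelianization" is "(1, 1)" .

lift_definition plus_abelianization :: "'a abelianization \<Rightarrow> 'a abelianization \<Rightarrow> 'a abelianization"
  is "\<lambda>p q. (fst p + fst q, snd p + snd q)"
  by (auto simp: congruent_modulo_commutators_def add_diff_add intro: ideal_of_add)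

lift_definition uminus_abelianization :: "'a abelianization \<Rightarrow> 'a abelianization"
  is "\<lambda>p. (- fst p, - snd p)"
  by (auto simp: congruent_modulo_commutators_def dest: ideal_of_uminus)

lift_definition minus_abelianization :: "'a abelianization \<Rightarrow> 'a abelianization \<Rightarrow> 'a abelianization"
  is "\<lambda>p q. (fst p - fst q, snd p - snd q)"
proof -
  fix p p' q q' :: "'a \<times> int"
  assume "congruent_modulo_commutators p p'" "congruent_modulo_commutators q q'"
  then have "(fst p - fst p') - (fst q - fst q') \<in> commutator_ideal"
    and "snd p - snd q = snd p' - snd q'"
    unfolding congruent_modulo_commutators_def by (blast intro: ideal_of_diff, simp)
  then show "congruent_modulo_commutators (fst p - fst q, snd p - snd q)
      (fst p' - fst q', snd p' - snd q')"
    by (simp add: congruent_modulo_commutators_def algebra_simps)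
qed

lift_definition times_abelianization :: "'a abelianization \<Rightarrow> 'a abelianization \<Rightarrow> 'a abelianization"
  is "\<lambda>p q. (fst p * fst q, snd p * snd q)"
proof -
  fix p p' q q' :: "'a \<times> int"
  assume "congruent_modulo_commutators p p'" "congruent_modulo_commutators q q'"
  moreover have "fst p * fst q - fst p' * fst q' =
      (fst p - fst p') * fst q + fst p' * (fst q - fst q')"
    by (simp add: algebra_simps)
  ultimately show "congruent_modulo_commutators (fst p * fst q, snd p * snd q)
      (fst p' * fst q', snd p' * snd q')"
    by (simp add: congruent_modulo_commutators_def ideal_of_closed)
qed

instance
proof
  fix a b c :: "'a abelianization"
  show "a + b + c = a + (b + c)"
    by transfer (simp add: congruent_modulo_commutators_def ideal_of.zero add.assoc)
  show "a + b = b + a"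
    by transfer (simp add: congruent_modulo_commutators_def ideal_of.zero add.commute)
  show "0 + a = a"
    by transfer (simp add: congruent_modulo_commutators_def ideal_of.zero)
  show "- a + a = 0"
    by transfer (simp add: congruent_modulo_commutators_def ideal_of.zero)
  show "a - b = a + - b"
    by transfer (simp add: congruent_modulo_commutators_def ideal_of.zero)
  show "a * b * c = a * (b * c)"
    by transfer (simp add: congruent_modulo_commutators_def ideal_of.zero mult.assoc)
  show "1 * a = a"
    by transfer (simp add: congruent_modulo_commutators_def ideal_of.zero)
  show "(a + b) * c = a * c + b * c"
    by transfer (simp add: congruent_modulo_commutators_def ideal_of.zero distrib_right)
  show "(0 :: 'a abelianization) \<noteq> 1"
    by transfer (simp add: congruent_modulo_commutators_def)
  show "a * b = b * a"
  proof transfer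
    fix p q :: "'a \<times> int"
    have "commutator (fst p) (fst q) \<in> commutator_ideal"
      by (rule ideal_of_base) auto
    then show "congruent_modulo_commutators (fst p * fst q, snd p * snd q)
        (fst q * fst p, snd q * snd p)"
      by (simp add: congruent_modulo_commutators_def commutator_def mult.commute)
  qed
qed

end

lift_definition abel_class :: "'a :: ring_1 \<Rightarrow> int \<Rightarrow> 'a abelianization" is Pair .

lemma abel_class_arith:
  "0 = abel_class 0 0"
  "1 = abel_class 1 1"
  "abel_class x k + abel_class y l = abel_class (x + y) (k + l)"
  "abel_class x k * abel_class y l = abel_class (x * y) (k * l)"
  by (transfer, simp add: congruent_modulo_commutators_def ideal_of.zero)+

lemma abel_class_sum: "(\<Sum>i\<in>I. abel_class (f i) (g i)) = abel_class (sum f I) (sum g I)"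
  by (induction I rule: infinite_finite_induct) (simp_all add: abel_class_arith)

lemma abel_class_eqD: "abel_class x k = abel_class y l \<Longrightarrow> x - y \<in> commutator_ideal"
  by transfer (simp add: congruent_modulo_commutators_def)

lemma abel_class_surj: "\<exists>x k. c = abel_class x k"
  by transfer (auto simp: congruent_modulo_commutators_def ideal_of.zero)

text \<open>
  The class map in the first component alone would not preserve \<open>1\<close>, so the integer component of
  every matrix is taken to be the identity matrix. This map is multiplicative and unital, though
  not additive.
\<close>
definition abel_mat :: "nat \<Rightarrow> 'a :: ring_1 mat \<Rightarrow> 'a abelianization mat" where
  "abel_mat n A = mat n n (\<lambda>(i, j). abel_class (A $$ (i, j)) (if i = j then 1 else 0))"

lemma abel_mat_carrier: "abel_mat n A \<in> carrier_mat n n"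
  by (simp add: abel_mat_def)

lemma abel_mat_one: "abel_mat n (1\<^sub>m n) = 1\<^sub>m n"
  by (rule eq_matI) (auto simp: abel_mat_def abel_class_arith)

lemma abel_mat_mult:
  assumes "A \<in> carrier_mat n n" and "B \<in> carrier_mat n n"
  shows "abel_mat n (A * B) = abel_mat n A * abel_mat n B"
proof (rule eq_matI)
  fix i j assume "i < dim_row (abel_mat n A * abel_mat n B)" "j < dim_col (abel_mat n A * abel_mat n B)"
  then have ij: "i < n" "j < n" by (auto simp: abel_mat_def)
  have "(\<Sum>k = 0..<n. (if i = k then 1 else 0) * (if k = j then 1 else 0)) = (if i = j then 1 else (0 :: int))"
    using ij by (simp add: sum.delta if_distrib[of "\<lambda>x. x * _"] cong: if_cong)
  then show "abel_mat n (A * B) $$ (i, j) = (abel_mat n A * abel_mat n B) $$ (i, j)"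
    using ij assms by (simp add: abel_mat_def scalar_prod_def abel_class_arith abel_class_sum)
qed (auto simp: abel_mat_def)

lemma abel_mat_pow:
  assumes "A \<in> carrier_mat n n"
  shows "abel_mat n (A ^\<^sub>m k) = abel_mat n A ^\<^sub>m k"
proof (induction k)
  case 0
  then show ?case using assms by (simp add: abel_mat_one) (simp add: abel_mat_def)
next
  case (Suc k)
  then show ?case using assms by (simp add: abel_mat_mult)
qed

section \<open>Inverses as polynomials\<close>

text \<open>
  Compare the coefficients in \<open>(1 - X B) adj (1 - X B) = det (1 - X B)\<close>. With \<open>D\<^sub>k\<close> and \<open>d\<^sub>k\<close>
  the coefficients of the adjugate and of the determinant, \<open>D\<^sub>k\<^sub>+\<^sub>1 = B D\<^sub>k + d\<^sub>k\<^sub>+\<^sub>1\<close>, so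
  multiplying by powers of \<open>A = B\<^sup>-\<^sup>1\<close> telescopes to \<open>A\<^sup>k D\<^sub>k = \<Sum>\<^sub>l\<^sub>\<le>\<^sub>k d\<^sub>l A\<^sup>l\<close>. For large
  \<open>k\<close> the left side is zero, and \<open>d\<^sub>0 = 1\<close>.
\<close>
lemma one_is_polynomial_multiple_comm:
  fixes A B :: "'a :: comm_ring_1 mat"
  assumes A: "A \<in> carrier_mat n n" and B: "B \<in> carrier_mat n n" and AB: "A * B = 1\<^sub>m n"
  shows "\<exists>(c :: nat \<Rightarrow> 'a) K. \<forall>i<n. \<forall>j<n.
    1\<^sub>m n $$ (i, j) = (\<Sum>l<K. c l * (A ^\<^sub>m Suc l) $$ (i, j))"
proof -
  define M where "M = mat n n (\<lambda>(i, j). [: 1\<^sub>m n $$ (i, j), - B $$ (i, j) :])"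
  have M: "M \<in> carrier_mat n n" by (simp add: M_def)
  note adj = adj_mat[OF M]
  define d where "d = coeff (det M)"
  define D where "D k = mat n n (\<lambda>(i, j). coeff (adj_mat M $$ (i, j)) k)" for k
  have D: "D k \<in> carrier_mat n n" for k by (simp add: D_def)
  have coeff_eq: "coeff ((M * adj_mat M) $$ (i, j)) k = (if i = j then d k else 0)"
    if "i < n" "j < n" for i j k
    using that unfolding adj(2) by (simp add: d_def)
  have coeff_prod: "coeff ((M * adj_mat M) $$ (i, j)) k =
      (\<Sum>a = 0..<n. 1\<^sub>m n $$ (i, a) * D k $$ (a, j)) -
      (case k of 0 \<Rightarrow> 0 | Suc k' \<Rightarrow> (\<Sum>a = 0..<n. B $$ (i, a) * D k' $$ (a, j)))"
    if "i < n" "j < n" for i j k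
    using that M adj(1)
    by (cases k)
      (simp_all add: scalar_prod_def M_def D_def coeff_sum sum_subtractf sum_negf)
  have mult_entry: "(\<Sum>a = 0..<n. X $$ (i, a) * Y $$ (a, j)) = (X * Y) $$ (i, j)"
    if "i < n" "j < n" "X \<in> carrier_mat n n" "Y \<in> carrier_mat n n" for X Y :: "'a mat" and i j
    using that by (auto simp: scalar_prod_def)
  have D0: "D 0 = d 0 \<cdot>\<^sub>m 1\<^sub>m n"
  proof (rule eq_matI)
    fix i j assume "i < dim_row (d 0 \<cdot>\<^sub>m 1\<^sub>m n)" "j < dim_col (d 0 \<cdot>\<^sub>m 1\<^sub>m n)"
    then have ij: "i < n" "j < n" by auto
    have "D 0 $$ (i, j) = coeff ((M * adj_mat M) $$ (i, j)) 0"
      using ij D[of 0] by (simp only: coeff_prod mult_entry one_carrier_mat) simp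
    then show "D 0 $$ (i, j) = (d 0 \<cdot>\<^sub>m 1\<^sub>m n) $$ (i, j)"
      using ij by (simp only: coeff_eq) simp
  qed (use D[of 0] in auto)
  have D_Suc: "D (Suc k) = B * D k + d (Suc k) \<cdot>\<^sub>m 1\<^sub>m n" for k
  proof (rule eq_matI)
    fix i j assume "i < dim_row (B * D k + d (Suc k) \<cdot>\<^sub>m 1\<^sub>m n)"
      "j < dim_col (B * D k + d (Suc k) \<cdot>\<^sub>m 1\<^sub>m n)"
    then have ij: "i < n" "j < n" by auto
    have "D (Suc k) $$ (i, j) - (B * D k) $$ (i, j) = coeff ((M * adj_mat M) $$ (i, j)) (Suc k)"
      using ij D[of "Suc k"] D[of k] B
      by (simp add: coeff_prod mult_entry del: index_mult_mat(1) index_one_mat(1))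
    also have "\<dots> = (if i = j then d (Suc k) else 0)"
      using ij by (rule coeff_eq)
    finally have "D (Suc k) $$ (i, j) = (B * D k) $$ (i, j) + (if i = j then d (Suc k) else 0)"
      by (simp add: algebra_simps)
    then show "D (Suc k) $$ (i, j) = (B * D k + d (Suc k) \<cdot>\<^sub>m 1\<^sub>m n) $$ (i, j)"
      using ij B D[of k] by (auto simp del: index_mult_mat)
  qed (use D[of "Suc k"] B in auto)
  have telescope: "(A ^\<^sub>m k * D k) $$ (i, j) = (\<Sum>l\<le>k. d l * (A ^\<^sub>m l) $$ (i, j))"
    if ij: "i < n" "j < n" for i j k
  proof (induction k)
    case 0
    show ?case using ij A by (simp add: D0)
  next
    case (Suc k)
    have P: "A ^\<^sub>m k \<in> carrier_mat n n" "A ^\<^sub>m Suc k \<in> carrier_mat n n" using A by auto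
    have "A ^\<^sub>m k * A * (B * D k) = A ^\<^sub>m k * ((A * B) * D k)"
      using P(1) A B D[of k] by (simp add: assoc_mult_mat[of _ n n _ n _ n] del: AB)
    also have "\<dots> = A ^\<^sub>m k * D k"
      using D[of k] by (simp add: AB)
    finally have "A ^\<^sub>m Suc k * D (Suc k) = A ^\<^sub>m k * D k + d (Suc k) \<cdot>\<^sub>m A ^\<^sub>m Suc k"
      using P B D[of k] A
      by (simp add: D_Suc mult_add_distrib_mat[of _ n n _ n] mult_smult_distrib[of _ n n _ n])
    then have "(A ^\<^sub>m Suc k * D (Suc k)) $$ (i, j) =
        (A ^\<^sub>m k * D k) $$ (i, j) + d (Suc k) * (A ^\<^sub>m Suc k) $$ (i, j)"
      using ij P D[of k] A by (simp del: index_mult_mat(1) pow_mat.simps)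
    then show ?case using Suc.IH by (simp del: index_mult_mat(1) pow_mat.simps)
  qed
  \<comment> \<open>Taking constant terms is the substitution \<open>X = 0\<close>, which turns \<open>1 - X B\<close> into \<open>1\<close>.\<close>
  interpret ev: comm_ring_hom "\<lambda>p :: 'a poly. coeff p 0"
    by unfold_locales (auto simp: coeff_mult)
  have "map_mat (\<lambda>p. coeff p 0) M = 1\<^sub>m n"
    by (rule eq_matI) (auto simp: M_def)
  then have d0: "d 0 = 1"
    using ev.hom_det[of M] by (simp add: d_def)
  define K where "K = Suc (Max (insert 0 ((\<lambda>(i, j). degree (adj_mat M $$ (i, j))) ` ({..<n} \<times> {..<n}))))"
  have "degree (adj_mat M $$ (i, j)) < K" if "i < n" "j < n" for i j
    unfolding K_def less_Suc_eq_le using that by (intro Max_ge) force+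
  then have DK: "D K = 0\<^sub>m n n"
    by (intro eq_matI) (auto simp: D_def coeff_eq_0)
  have "1\<^sub>m n $$ (i, j) = (\<Sum>l<K. - d (Suc l) * (A ^\<^sub>m Suc l) $$ (i, j))"
    if ij: "i < n" "j < n" for i j
  proof -
    have "A ^\<^sub>m K * D K = 0\<^sub>m n n"
      unfolding DK using A by (intro right_mult_zero_mat) auto
    then have "0 = (\<Sum>l\<le>K. d l * (A ^\<^sub>m l) $$ (i, j))"
      using telescope[OF ij, of K] ij by simp
    also have "\<dots> = d 0 * (A ^\<^sub>m 0) $$ (i, j) + (\<Sum>l<K. d (Suc l) * (A ^\<^sub>m Suc l) $$ (i, j))"
      by (simp only: lessThan_Suc_atMost[symmetric] sum.lessThan_Suc_shift)
    finally show ?thesis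
      using A by (simp add: d0 sum_negf eq_neg_iff_add_eq_0 del: index_one_mat pow_mat.simps(2))
  qed
  then show ?thesis by (intro exI[of _ "\<lambda>l. - d (Suc l)"] exI[of _ K] allI impI)
qed

lemma one_is_polynomial_multiple_modulo_commutators:
  fixes A B :: "'a :: ring_1 mat"
  assumes A: "A \<in> carrier_mat n n" and B: "B \<in> carrier_mat n n" and AB: "A * B = 1\<^sub>m n"
  shows "\<exists>(c :: nat \<Rightarrow> 'a) K. \<forall>i<n. \<forall>j<n.
    1\<^sub>m n $$ (i, j) - (\<Sum>l<K. c l * (A ^\<^sub>m Suc l) $$ (i, j)) \<in> commutator_ideal"
proof -
  have "abel_mat n A * abel_mat n B = 1\<^sub>m n"
    using abel_mat_mult[OF A B] by (simp add: AB abel_mat_one)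
  from one_is_polynomial_multiple_comm[OF abel_mat_carrier abel_mat_carrier this]
  obtain c K where c: "\<And>i j. i < n \<Longrightarrow> j < n \<Longrightarrow>
      1\<^sub>m n $$ (i, j) = (\<Sum>l<K. c l * (abel_mat n A ^\<^sub>m Suc l) $$ (i, j))"
    by blast
  have "\<forall>l. \<exists>x k. c l = abel_class x k" using abel_class_surj by blast
  then obtain r z where rz: "\<And>l. c l = abel_class (r l) (z l)" by metis
  have "1\<^sub>m n $$ (i, j) - (\<Sum>l<K. r l * (A ^\<^sub>m Suc l) $$ (i, j)) \<in> commutator_ideal"
    if ij: "i < n" "j < n" for i j
  proof -
    let ?e = "if i = j then 1 else 0 :: int"
    have "abel_class (1\<^sub>m n $$ (i, j)) ?e = abel_mat n (1\<^sub>m n) $$ (i, j)"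
      using ij by (simp add: abel_mat_def)
    also have "\<dots> = (\<Sum>l<K. c l * abel_mat n (A ^\<^sub>m Suc l) $$ (i, j))"
      unfolding abel_mat_one c[OF ij] abel_mat_pow[OF A] ..
    also have "\<dots> = (\<Sum>l<K. abel_class (r l * (A ^\<^sub>m Suc l) $$ (i, j)) (z l * ?e))"
      using ij by (simp add: abel_mat_def rz abel_class_arith del: pow_mat.simps)
    finally show ?thesis
      unfolding abel_class_sum by (rule abel_class_eqD)
  qed
  then show ?thesis by (intro exI[of _ r] exI[of _ K] allI impI)
qed

section \<open>Subrings of the matrix ring\<close>

text \<open>
  The geometric series for \<open>1 - E = G A\<close> is written as \<open>1 = E\<^sup>k + H\<^sub>k A\<close> with \<open>H\<^sub>k \<in> S\<close>: multiplying
  \<open>E\<^sup>k\<close> by \<open>1 = E + G A\<close> leads from \<open>k\<close> to \<open>k + 1\<close>. When \<open>E\<^sup>k\<close> vanishes, \<open>H\<^sub>k\<close> is a left inverse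
  of \<open>A\<close>, and therefore equal to the right inverse \<open>B\<close>.
\<close>
lemma unit_inverse_in_subring:
  fixes S :: "'a :: ring_1 mat set"
  assumes nil: "lower_commutators m \<subseteq> {0 :: 'a}"
    and carrier: "S \<subseteq> carrier_mat n n"
    and add: "\<And>X Y. X \<in> S \<Longrightarrow> Y \<in> S \<Longrightarrow> X + Y \<in> S"
    and mult: "\<And>X Y. X \<in> S \<Longrightarrow> Y \<in> S \<Longrightarrow> X * Y \<in> S"
    and scalar: "\<And>r. r \<cdot>\<^sub>m 1\<^sub>m n \<in> S"
    and AS: "A \<in> S" and B: "B \<in> carrier_mat n n" and AB: "A * B = 1\<^sub>m n"
  shows "B \<in> S"
proof -
  have A: "A \<in> carrier_mat n n" using AS carrier by blast
  have smult: "r \<cdot>\<^sub>m X \<in> S" if "X \<in> S" for r X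
  proof -
    have X: "X \<in> carrier_mat n n" using that carrier by blast
    have "r \<cdot>\<^sub>m 1\<^sub>m n * X = r \<cdot>\<^sub>m X"
    proof (rule eq_matI)
      fix i j assume "i < dim_row (r \<cdot>\<^sub>m X)" "j < dim_col (r \<cdot>\<^sub>m X)"
      with X show "(r \<cdot>\<^sub>m 1\<^sub>m n * X) $$ (i, j) = (r \<cdot>\<^sub>m X) $$ (i, j)"
        by (simp add: scalar_prod_def if_distrib[of "\<lambda>x. x * _"] if_distrib[of "\<lambda>x. _ * x"]
            mult.assoc sum.delta cong: if_cong)
    qed (use X in auto)
    then show ?thesis using mult[OF scalar[of r] that] by simp
  qed
  have one: "1\<^sub>m n \<in> S"
  proof -
    have "1 \<cdot>\<^sub>m 1\<^sub>m n = (1\<^sub>m n :: 'a mat)" by (intro eq_matI) auto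
    then show ?thesis using scalar[of 1] by simp
  qed
  have zero: "0\<^sub>m n n \<in> S"
  proof -
    have "0 \<cdot>\<^sub>m 1\<^sub>m n = (0\<^sub>m n n :: 'a mat)" by (intro eq_matI) auto
    then show ?thesis using scalar[of 0] by simp
  qed
  have pow: "X ^\<^sub>m k \<in> S" if "X \<in> S" for X k
  proof (induction k)
    case 0
    have "X \<in> carrier_mat n n" using that carrier by blast
    then show ?case using one by simp
  qed (simp add: mult that)
  obtain c K where c: "\<And>i j. i < n \<Longrightarrow> j < n \<Longrightarrow>
      1\<^sub>m n $$ (i, j) - (\<Sum>l<K. c l * (A ^\<^sub>m Suc l) $$ (i, j)) \<in> (commutator_ideal :: 'a set)"
    using one_is_polynomial_multiple_modulo_commutators[OF A B AB] by blast
  have partial: "\<exists>G\<in>S. \<forall>i<n. \<forall>j<n. (G * A) $$ (i, j) = (\<Sum>l<k. c l * (A ^\<^sub>m Suc l) $$ (i, j))" for k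
  proof (induction k)
    case 0
    show ?case using A by (intro bexI[OF _ zero]) simp
  next
    case (Suc k)
    then obtain G where G: "G \<in> S"
      and GA: "\<And>i j. i < n \<Longrightarrow> j < n \<Longrightarrow> (G * A) $$ (i, j) = (\<Sum>l<k. c l * (A ^\<^sub>m Suc l) $$ (i, j))"
      by blast
    have Gc: "G \<in> carrier_mat n n" using G carrier by blast
    have P: "A ^\<^sub>m k \<in> carrier_mat n n" using A by simp
    have "(c k \<cdot>\<^sub>m A ^\<^sub>m k) * A = c k \<cdot>\<^sub>m A ^\<^sub>m Suc k"
      using P A by (intro eq_matI) (auto simp: scalar_prod_def sum_distrib_left mult.assoc)
    then have "(G + c k \<cdot>\<^sub>m A ^\<^sub>m k) * A = G * A + c k \<cdot>\<^sub>m A ^\<^sub>m Suc k"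
      using Gc P A by (simp add: add_mult_distrib_mat[of _ n n])
    then have "((G + c k \<cdot>\<^sub>m A ^\<^sub>m k) * A) $$ (i, j) = (\<Sum>l<Suc k. c l * (A ^\<^sub>m Suc l) $$ (i, j))"
      if "i < n" "j < n" for i j
      using that GA A Gc by (simp del: index_mult_mat(1) pow_mat.simps)
    moreover have "G + c k \<cdot>\<^sub>m A ^\<^sub>m k \<in> S"
      by (intro add smult pow G AS)
    ultimately show ?case by blast
  qed
  obtain G where G: "G \<in> S" and GA: "\<And>i j. i < n \<Longrightarrow> j < n \<Longrightarrow>
      (G * A) $$ (i, j) = (\<Sum>l<K. c l * (A ^\<^sub>m Suc l) $$ (i, j))"
    using partial[of K] by blast
  have Gc: "G \<in> carrier_mat n n" using G carrier by blast
  define E where "E = 1\<^sub>m n + (- 1) \<cdot>\<^sub>m (G * A)"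
  have ES: "E \<in> S" unfolding E_def by (intro add one smult mult G AS)
  then have E: "E \<in> carrier_mat n n" using carrier by blast
  have "E \<in> mats_over n commutator_ideal"
    using E c Gc A by (auto simp: mats_over_def E_def GA simp del: index_mult_mat(1) index_one_mat pow_mat.simps)
  then obtain t where t: "E ^\<^sub>m t = 0\<^sub>m n n"
    using commutator_matrix_nilpotent[OF _ nil] by blast
  have split: "E + G * A = 1\<^sub>m n"
    using Gc A by (intro eq_matI) (auto simp: E_def simp del: index_mult_mat(1))
  have "\<exists>H\<in>S. 1\<^sub>m n = E ^\<^sub>m k + H * A" for k
  proof (induction k)
    case 0
    show ?case using A E by (intro bexI[OF _ zero]) simp
  next
    case (Suc k)
    then obtain H where H: "H \<in> S" and eq: "1\<^sub>m n = E ^\<^sub>m k + H * A" by blast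
    have Hc: "H \<in> carrier_mat n n" using H carrier by blast
    have P: "E ^\<^sub>m k \<in> carrier_mat n n" using E by simp
    have "E ^\<^sub>m k = E ^\<^sub>m k * (E + G * A)"
      using P by (simp add: split right_mult_one_mat[OF P])
    also have "\<dots> = E ^\<^sub>m Suc k + (E ^\<^sub>m k * G) * A"
      using P E Gc A by (simp add: mult_add_distrib_mat[of _ n n _ n] assoc_mult_mat[of _ n n _ n _ n])
    finally have "1\<^sub>m n = E ^\<^sub>m Suc k + (E ^\<^sub>m k * G) * A + H * A"
      using eq by simp
    also have "\<dots> = E ^\<^sub>m Suc k + ((E ^\<^sub>m k * G) * A + H * A)"
      using P E Gc A Hc by (intro assoc_add_mat[of _ n n] mult_carrier_mat pow_carrier_mat)
    also have "(E ^\<^sub>m k * G) * A + H * A = (E ^\<^sub>m k * G + H) * A"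
      using P Gc A Hc by (intro add_mult_distrib_mat[of _ n n, symmetric] mult_carrier_mat)
    finally show ?case
      by (intro bexI[of _ "E ^\<^sub>m k * G + H"] add mult pow ES G H)
  qed
  from this[of t] obtain H where H: "H \<in> S" and "1\<^sub>m n = 0\<^sub>m n n + H * A"
    unfolding t by blast
  then have Hc: "H \<in> carrier_mat n n" and HA: "H * A = 1\<^sub>m n"
    using carrier A by auto
  have "H = H * (A * B)" using Hc by (simp add: AB)
  also have "\<dots> = (H * A) * B" using Hc A B by simp
  also have "\<dots> = B" using B by (simp add: HA)
  finally show ?thesis using H by simp
qed

theorem theorem2p9:
  fixes m n :: nat and S :: "'a :: ring_1 mat set"
  assumes "m \<ge> 1" and "n \<ge> 1"
    and "\<And>k :: int. k \<noteq> 0 \<Longrightarrow> \<exists>y :: 'a. of_int k * y = 1 \<and> y * of_int k = 1"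
    and "\<And>x :: nat \<Rightarrow> 'a. left_normed_commutator x (m + 1) = 0"
    and "subring S (ring_mat TYPE('a) n ())"
    and "{r \<cdot>\<^sub>m 1\<^sub>m n | r :: 'a. True} \<subseteq> S"
  shows "S \<inter> Units (ring_mat TYPE('a) n ()) =
         Units ((ring_mat TYPE('a) n ()) \<lparr>carrier := S\<rparr>)"
proof
  have carrier: "S \<subseteq> carrier_mat n n"
    and mult: "\<And>X Y. X \<in> S \<Longrightarrow> Y \<in> S \<Longrightarrow> X * Y \<in> S"
    and add: "\<And>X Y. X \<in> S \<Longrightarrow> Y \<in> S \<Longrightarrow> X + Y \<in> S"
    using subringE(1,6,7)[OF assms(5)] by (simp_all add: ring_mat_simps)
  have nil: "lower_commutators m \<subseteq> {0 :: 'a}"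
    using lower_commutators_left_normed[where 'a = 'a, of _ m] assms(4) by fastforce
  show "S \<inter> Units (ring_mat TYPE('a) n ()) \<subseteq> Units ((ring_mat TYPE('a) n ()) \<lparr>carrier := S\<rparr>)"
  proof
    fix A assume "A \<in> S \<inter> Units (ring_mat TYPE('a) n ())"
    then obtain B where A: "A \<in> S" and B: "B \<in> carrier_mat n n" "B * A = 1\<^sub>m n" "A * B = 1\<^sub>m n"
      by (auto simp: Units_def ring_mat_simps)
    have "B \<in> S"
      using unit_inverse_in_subring[OF nil carrier add mult _ A B(1,3)] assms(6) by blast
    with A B show "A \<in> Units ((ring_mat TYPE('a) n ()) \<lparr>carrier := S\<rparr>)"
      by (auto simp: Units_def ring_mat_simps)
  qed
  show "Units ((ring_mat TYPE('a) n ()) \<lparr>carrier := S\<rparr>) \<subseteq> S \<inter> Units (ring_mat TYPE('a) n ())"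
    using carrier by (auto simp: Units_def ring_mat_simps)
qed

end
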